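(* Let $H$; $K_1,\ldots,K_r$ be connected graphs with pairwise disjoint vertex sets $V_H$; $V_1,\ldots,V_r$, carrying weight functions $\alpha:V_H\to[0,\infty)$ and $\beta_i:V_i\to[0,\infty)$, $i=1,\ldots,r$. Put $A=\sum_{u\in V_H}\alpha(u)$, $B_i=\sum_{v\in V_i}\beta_i(v)$, $B=\sum_{i=1}^r B_i$ and $W=A+B$. Let $x_1,\ldots,x_r\in V_H$ and $y_i\in V_i$ ($i=1,\ldots,r$), and let $G=(V,E)$ be the graft product of $H$ with $K_1,\ldots,K_r$ at the pairs $(x_i,y_i)$, so that $|V|=|V_H|+|V_1|+\cdots+|V_r|-r$, with weight function $\gamma=\alpha+\beta_1+\cdots+\beta_r$. Then $$ M_G^{\gamma}=M_{H}^{\alpha}+\sum_{i=1}^r M_{K_i}^{\beta_i}+\sum_{i=1}^r M_H^{\xi_i}(x_i)+\sum_{i=1}^r M_{K_i}^{\eta_i}(y_i)+\sum_{i,j=1}^r(|V_i|-1)\operatorname{dist}_H(x_i,x_j)B_j, $$ where $\xi_i=(|V_i|-1)\alpha+B_i$ (a function on $V_H$) and $\eta_i=(|V|-|V_i|)\beta_i+W-B_i$ (a function on $V_i$), for $i=1,\ldots,r$.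
   Context: For a connected graph $G$ with vertex set $V$, distance function $\operatorname{dist}$, and a function $\rho:V\to\mathbb{R}$ (a weight function; a constant $c$ denotes the constant function $c$), the $\rho$-moment of $G$ at $u\in V$ is $M_G^{\rho}(u)=\sum_{v\in V}\rho(v)\operatorname{dist}(v,u)$, and the $\rho$-moment of $G$ is $M_G^{\rho}=\sum_{u\in V}M_G^{\rho}(u)$. The graft product of $H$ with $K_1,\ldots,K_r$ at the pairs $(x_i,y_i)$ is the graph obtained from the disjoint union of $H,K_1,\ldots,K_r$ by identifying $x_i$ with $y_i$ for every $i=1,\ldots,r$. Its weight function $\gamma=\alpha+\beta_1+\cdots+\beta_r$ is given by $\gamma(v)=\alpha(v)+\sum_{i:\,x_i=v}\beta_i(y_i)$ for $v\in V_H$ (so $\gamma(x)=\alpha(x)$ if $x$ is not among the $x_i$, and $\gamma(x_i)=\alpha(x_i)+\beta_i(y_i)$ when the $x_i$ are distinct), and $\gamma(y)=\beta_i(y)$ for $y\in V_i\setminus\{y_i\}$. In the formula, $\operatorname{dist}_H$ is the distance in $H$, and $M_H^{\xi_i}(x_i)$, $M_{K_i}^{\eta_i}(y_i)$ are moments computed in $H$ and $K_i$ respectively. *)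

theory Defs
  imports Complex_Main "HOL-Library.Disjoint_Sets" "Graph_Theory.Graph_Theory"
begin

text \<open>
  A finite simple graph is a symmetric loopfree digraph whose arcs are pairs of vertices
  (\<^locale>\<open>pair_graph\<close>); each edge is present as two opposite arcs.

  The distance is the cost of a shortest walk when every arc costs 1. In a connected graph the
  extended real involved is finite on all pairs of vertices, so no information is lost by
  \<^const>\<open>real_of_ereal\<close> (see \<open>graph_dist_shortest_walk\<close> below).
\<close>

definition graph_dist :: "'a pair_pre_digraph \<Rightarrow> 'a \<Rightarrow> 'a \<Rightarrow> real" where
  "graph_dist G u v = real_of_ereal (wf_digraph.\<mu> (with_proj G) (\<lambda>_. 1) u v)"

definition moment_at :: "'a pair_pre_digraph \<Rightarrow> ('a \<Rightarrow> real) \<Rightarrow> 'a \<Rightarrow> real" where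
  "moment_at G \<rho> u = (\<Sum>v\<in>pverts G. \<rho> v * graph_dist G v u)"

definition moment :: "'a pair_pre_digraph \<Rightarrow> ('a \<Rightarrow> real) \<Rightarrow> real" where
  "moment G \<rho> = (\<Sum>u\<in>pverts G. moment_at G \<rho> u)"

text \<open>
  The graft product of \<open>H\<close> with \<open>K 1, \<dots>, K r\<close> at the pairs \<open>(x i, y i)\<close>, for graphs with pairwise
  disjoint vertex sets. The vertex of the quotient that arises from \<open>x i\<close> and \<open>y i\<close> is represented
  by \<open>x i\<close>; so the vertices are those of \<open>H\<close> together with those of the \<open>K i\<close> other than \<open>y i\<close>. The
  \<open>x i\<close> need not be distinct.
\<close>

definition glue :: "'a \<Rightarrow> 'a \<Rightarrow> 'a \<Rightarrow> 'a" where
  "glue a b v = (if v = b then a else v)"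

definition graft ::
  "'a pair_pre_digraph \<Rightarrow> nat \<Rightarrow> (nat \<Rightarrow> 'a pair_pre_digraph) \<Rightarrow> (nat \<Rightarrow> 'a) \<Rightarrow> (nat \<Rightarrow> 'a)
    \<Rightarrow> 'a pair_pre_digraph" where
  "graft H r K x y =
    \<lparr> pverts = pverts H \<union> (\<Union>i\<in>{1..r}. glue (x i) (y i) ` pverts (K i)),
      parcs = parcs H \<union> (\<Union>i\<in>{1..r}. map_prod (glue (x i) (y i)) (glue (x i) (y i)) ` parcs (K i)) \<rparr>"

text \<open>
  The weight function \<open>\<alpha> + \<beta> 1 + \<dots> + \<beta> r\<close>. At a vertex outside \<open>H\<close>, exactly one index
  qualifies, the vertex sets of the \<open>K i\<close> being disjoint.
\<close>

definition graft_weight ::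
  "'a pair_pre_digraph \<Rightarrow> nat \<Rightarrow> (nat \<Rightarrow> 'a pair_pre_digraph) \<Rightarrow> (nat \<Rightarrow> 'a) \<Rightarrow> (nat \<Rightarrow> 'a)
    \<Rightarrow> ('a \<Rightarrow> real) \<Rightarrow> (nat \<Rightarrow> 'a \<Rightarrow> real) \<Rightarrow> 'a \<Rightarrow> real" where
  "graft_weight H r K x y \<alpha> \<beta> v =
    (if v \<in> pverts H then \<alpha> v + (\<Sum>i | i \<in> {1..r} \<and> x i = v. \<beta> i (y i))
     else \<beta> (THE i. i \<in> {1..r} \<and> v \<in> pverts (K i)) v)"

lemma connected_pair_graph_iff:
  assumes "pair_graph G"
  shows "Digraph_Component.connected (with_proj G) \<longleftrightarrow>
    pverts G \<noteq> {} \<and> (\<forall>u\<in>pverts G. \<forall>v\<in>pverts G. u \<rightarrow>\<^sup>*\<^bsub>with_proj G\<^esub> v)"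
proof -
  interpret pair_graph G by fact
  have "mk_symmetric (with_proj G) = G"
    using arcs_symmetric by (force simp: mk_symmetric_def intro!: pair_pre_digraph.equality)
  then show ?thesis
    by (simp add: Digraph_Component.connected_def strongly_connected_def)
qed

lemma graph_dist_shortest_walk:
  assumes "pair_graph G" "Digraph_Component.connected (with_proj G)"
    and "u \<in> pverts G" "v \<in> pverts G"
  shows "graph_dist G u v =
    real (LEAST n. \<exists>p. pre_digraph.awalk (with_proj G) u p v \<and> length p = n)"
proof -
  interpret pair_graph G by fact
  have cost: "awalk_cost (\<lambda>_. 1) p = real (length p)" for p
    by (simp add: awalk_cost_def sum_list_triv)
  let ?P = "\<lambda>n. \<exists>p. awalk u p v \<and> length p = n"
  have "u \<rightarrow>\<^sup>*\<^bsub>with_proj G\<^esub> v"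
    using assms connected_pair_graph_iff by blast
  then obtain p where "awalk u p v"
    by (auto simp: reachable_awalk)
  then have "\<exists>n. ?P n"
    by blast
  then have "?P (Least ?P)"
    by (rule LeastI_ex)
  then obtain q where q: "awalk u q v" "length q = Least ?P"
    by auto
  have "\<mu> (\<lambda>_. 1) u v = ereal (real (Least ?P))"
    unfolding \<mu>_def
  proof (rule INF_eqI)
    show "ereal (real (Least ?P)) \<le> ereal (awalk_cost (\<lambda>_. 1) p)" if "p \<in> {p. awalk u p v}" for p
      using that by (auto simp: cost intro: Least_le)
    show "z \<le> ereal (real (Least ?P))"
      if "\<And>p. p \<in> {p. awalk u p v} \<Longrightarrow> z \<le> ereal (awalk_cost (\<lambda>_. 1) p)" for z
      using that[of q] q by (simp add: cost)
  qed
  then show ?thesis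
    by (simp add: graph_dist_def)
qed

lemma parcs_graftE:
  assumes "(a, b) \<in> parcs (graft H r K x y)" "(a, b) \<notin> parcs H"
  obtains i c d where "i \<in> {1..r}" "(c, d) \<in> parcs (K i)"
    "a = glue (x i) (y i) c" "b = glue (x i) (y i) d"
proof -
  have "\<exists>i\<in>{1..r}. (a, b) \<in> map_prod (glue (x i) (y i)) (glue (x i) (y i)) ` parcs (K i)"
    using assms unfolding graft_def pair_pre_digraph.simps by (simp only: Un_iff UN_iff) blast
  then obtain i e where "i \<in> {1..r}" "e \<in> parcs (K i)"
    "(a, b) = map_prod (glue (x i) (y i)) (glue (x i) (y i)) e"
    by (metis imageE)
  then show ?thesis
    using that by (cases e) auto
qed

lemma graft_summands:
  shows "pverts H \<subseteq> pverts (graft H r K x y)" "parcs H \<subseteq> parcs (graft H r K x y)"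
    and "i \<in> {1..r} \<Longrightarrow> glue (x i) (y i) ` pverts (K i) \<subseteq> pverts (graft H r K x y)"
    and "i \<in> {1..r} \<Longrightarrow> map_prod (glue (x i) (y i)) (glue (x i) (y i)) ` parcs (K i)
      \<subseteq> parcs (graft H r K x y)"
  unfolding graft_def pair_pre_digraph.simps by blast+

lemma graft_pair_graph:
  assumes H: "pair_graph H" and K: "\<And>i. i \<in> {1..r} \<Longrightarrow> pair_graph (K i)"
    and disj: "\<And>i. i \<in> {1..r} \<Longrightarrow> pverts H \<inter> pverts (K i) = {}"
    and x: "\<And>i. i \<in> {1..r} \<Longrightarrow> x i \<in> pverts H"
  shows "pair_graph (graft H r K x y)"
proof -
  let ?G = "graft H r K x y"
  interpret H: pair_graph H by fact
  have wf: "a \<in> pverts ?G \<and> b \<in> pverts ?G" if "(a, b) \<in> parcs ?G" for a b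
  proof (cases "(a, b) \<in> parcs H")
    case True
    then show ?thesis
      using H.wellformed' graft_summands(1)[of H r K x y] by blast
  next
    case False
    with that obtain i c d where i: "i \<in> {1..r}" and cd: "(c, d) \<in> parcs (K i)"
      and e: "a = glue (x i) (y i) c" "b = glue (x i) (y i) d"
      by (rule parcs_graftE)
    interpret Ki: pair_graph "K i" using K i .
    show ?thesis
      using Ki.wellformed'[OF cd] graft_summands(3)[OF i, of x y K H] unfolding e by blast
  qed
  have Kfin: "finite (pverts (K i)) \<and> finite (parcs (K i))" if "i \<in> {1..r}" for i
  proof -
    interpret Ki: pair_graph "K i" using K that .
    show ?thesis using Ki.pair_finite_verts Ki.pair_finite_arcs by simp
  qed
  have fin: "finite (pverts ?G)" "finite (parcs ?G)"
    using H.pair_finite_verts H.pair_finite_arcs Kfin by (simp_all add: graft_def)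
  have loop: "a \<noteq> b" if "(a, b) \<in> parcs ?G" for a b
  proof (cases "(a, b) \<in> parcs H")
    case True
    then show ?thesis using H.pair_no_loops[of "(a, b)"] by simp
  next
    case False
    with that obtain i c d where i: "i \<in> {1..r}" and cd: "(c, d) \<in> parcs (K i)"
      and e: "a = glue (x i) (y i) c" "b = glue (x i) (y i) d"
      by (rule parcs_graftE)
    interpret Ki: pair_graph "K i" using K i .
    have "c \<noteq> d" "x i \<notin> pverts (K i)" "c \<in> pverts (K i)" "d \<in> pverts (K i)"
      using Ki.pair_no_loops[OF cd] Ki.wellformed'[OF cd] x[OF i] disj[OF i] by auto
    then show ?thesis
      unfolding e glue_def by (simp split: if_splits) metis
  qed
  have sym: "(b, a) \<in> parcs ?G" if "(a, b) \<in> parcs ?G" for a b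
  proof (cases "(a, b) \<in> parcs H")
    case True
    then show ?thesis using H.arcs_symmetric graft_summands(2)[of H r K x y] by blast
  next
    case False
    with that obtain i c d where i: "i \<in> {1..r}" and cd: "(c, d) \<in> parcs (K i)"
      and e: "a = glue (x i) (y i) c" "b = glue (x i) (y i) d"
      by (rule parcs_graftE)
    interpret Ki: pair_graph "K i" using K i .
    have "map_prod (glue (x i) (y i)) (glue (x i) (y i)) (d, c) \<in> parcs ?G"
      using Ki.arcs_symmetric[OF cd] graft_summands(4)[OF i, of x y K H] by blast
    then show ?thesis by (simp add: e)
  qed
  show ?thesis
  proof
    show "fst e \<in> pverts ?G" "snd e \<in> pverts ?G" "fst e \<noteq> snd e" if "e \<in> parcs ?G" for e
      using wf loop that by (cases e; simp)+
    show "symmetric (with_proj ?G)"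
      using sym by (simp add: symmetric_def sym_def)
  qed (fact fin)+
qed

lemma reachable_glue:
  assumes "u \<rightarrow>\<^sup>*\<^bsub>with_proj G\<^esub> v" and "pair_wf_digraph G'"
    and "f ` pverts G \<subseteq> pverts G'" "map_prod f f ` parcs G \<subseteq> parcs G'"
  shows "f u \<rightarrow>\<^sup>*\<^bsub>with_proj G'\<^esub> f v"
proof -
  interpret G': pair_wf_digraph G' by fact
  have "(u, v) \<in> rtrancl_on (pverts G) (parcs G)"
    using assms(1) by (simp add: reachable_def)
  then show ?thesis
  proof (induction rule: rtrancl_on.induct)
    case (rtrancl_on_refl a)
    then show ?case using assms(3) by auto
  next
    case (rtrancl_on_into_rtrancl_on a b c)
    then have "(f b, f c) \<in> parcs G'" using assms(4) by force
    then show ?case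
      using rtrancl_on_into_rtrancl_on.IH
      by (auto intro: wf_digraph.reachable_adj_trans[OF G'.wf_digraph, of _ "f b"])
  qed
qed

lemma graft_connected:
  assumes H: "pair_graph H" "Digraph_Component.connected (with_proj H)"
    and K: "\<And>i. i \<in> {1..r} \<Longrightarrow> pair_graph (K i) \<and> Digraph_Component.connected (with_proj (K i))"
    and disj: "\<And>i. i \<in> {1..r} \<Longrightarrow> pverts H \<inter> pverts (K i) = {}"
    and x: "\<And>i. i \<in> {1..r} \<Longrightarrow> x i \<in> pverts H" and y: "\<And>i. i \<in> {1..r} \<Longrightarrow> y i \<in> pverts (K i)"
  shows "Digraph_Component.connected (with_proj (graft H r K x y))"
proof -
  let ?G = "graft H r K x y"
  have G: "pair_graph ?G"
    by (rule graft_pair_graph) (use assms in auto)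
  interpret G: pair_graph ?G by fact
  have inH: "u \<rightarrow>\<^sup>*\<^bsub>with_proj ?G\<^esub> v" if "u \<in> pverts H" "v \<in> pverts H" for u v
  proof -
    have "u \<rightarrow>\<^sup>*\<^bsub>with_proj H\<^esub> v"
      using H that connected_pair_graph_iff by blast
    from reachable_glue[OF this G.pair_wf_digraph, of id] show ?thesis
      using graft_summands(1,2)[of H r K x y] by (simp add: map_prod.id)
  qed
  have toH: "\<exists>h\<in>pverts H. u \<rightarrow>\<^sup>*\<^bsub>with_proj ?G\<^esub> h \<and> h \<rightarrow>\<^sup>*\<^bsub>with_proj ?G\<^esub> u" if u: "u \<in> pverts ?G" for u
  proof (cases "u \<in> pverts H")
    case True
    then show ?thesis using inH by blast
  next
    case False
    then obtain i w where i: "i \<in> {1..r}" and w: "w \<in> pverts (K i)" "u = glue (x i) (y i) w"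
      using u unfolding graft_def pair_pre_digraph.simps by blast
    have "w \<rightarrow>\<^sup>*\<^bsub>with_proj (K i)\<^esub> y i" "y i \<rightarrow>\<^sup>*\<^bsub>with_proj (K i)\<^esub> w"
      using K[OF i] w y[OF i] connected_pair_graph_iff by blast+
    from this[THEN reachable_glue, OF G.pair_wf_digraph graft_summands(3,4)[OF i]]
    show ?thesis
      using x[OF i] unfolding w(2) by (intro bexI[of _ "x i"]) (simp_all add: glue_def)
  qed
  have "pverts ?G \<noteq> {}"
    using H connected_pair_graph_iff graft_summands(1)[of H r K x y] by blast
  moreover have "u \<rightarrow>\<^sup>*\<^bsub>with_proj ?G\<^esub> v" if uv: "u \<in> pverts ?G" "v \<in> pverts ?G" for u v
  proof -
    obtain h k where "h \<in> pverts H" "u \<rightarrow>\<^sup>*\<^bsub>with_proj ?G\<^esub> h"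
      and "k \<in> pverts H" "k \<rightarrow>\<^sup>*\<^bsub>with_proj ?G\<^esub> v"
      using toH[OF uv(1)] toH[OF uv(2)] by (elim bexE conjE)
    then show ?thesis
      using inH[of h k] by (blast intro: G.reachable_trans[of u h k] G.reachable_trans[of u k v])
  qed
  ultimately show ?thesis
    using connected_pair_graph_iff[OF G] by blast
qed

end

theory Submission
  imports Defs
begin

text \<open>
  On a connected graph the distance to \<open>t\<close> is the largest function that vanishes at \<open>t\<close> and changes
  by at most 1 along each arc. Functions of this kind on \<open>H\<close> and on the \<open>K i\<close> that agree at the glued
  vertices combine to one on the graft product. This bounds the distances of the graft product from
  below, the triangle inequality bounds them from above, and so a distance between different
  summands is the sum of the distances along the route through the gluing vertices. The moment
  formula follows by splitting the sums over sources and targets according to the summands.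
\<close>

section \<open>Distances in a connected graph\<close>

locale connected_pair_graph = pair_graph G for G :: "'a pair_pre_digraph" (structure) +
  assumes connected_G: "Digraph_Component.connected (with_proj G)"
begin

lemma dist_le_walk:
  assumes "awalk u p v"
  shows "graph_dist G u v \<le> real (length p)"
proof -
  have "u \<in> pverts G" "v \<in> pverts G"
    using assms awalk_hd_in_verts awalk_last_in_verts by auto
  then show ?thesis
    using graph_dist_shortest_walk[OF pair_graph connected_G, of u v] assms
    by (auto intro: Least_le)
qed

lemma shortest_walk:
  assumes "u \<in> pverts G" "v \<in> pverts G"
  obtains p where "awalk u p v" "graph_dist G u v = real (length p)"
proof -
  have "u \<rightarrow>\<^sup>*\<^bsub>with_proj G\<^esub> v"
    using connected_pair_graph_iff[OF pair_graph] connected_G assms by blast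
  then have "\<exists>n p. awalk u p v \<and> length p = n"
    by (auto simp: reachable_awalk)
  then have "\<exists>p. awalk u p v \<and> length p = (LEAST n. \<exists>p. awalk u p v \<and> length p = n)"
    by (rule LeastI_ex)
  then show ?thesis
    using that graph_dist_shortest_walk[OF pair_graph connected_G assms] by metis
qed

lemma dist_self [simp]: "u \<in> pverts G \<Longrightarrow> graph_dist G u u = 0"
proof -
  assume u: "u \<in> pverts G"
  then have "graph_dist G u u \<le> 0"
    using dist_le_walk[of u "[]" u] by (simp add: awalk_Nil_iff)
  moreover have "graph_dist G u u \<ge> 0"
    by (rule shortest_walk[OF u u]) simp
  ultimately show ?thesis by simp
qed

lemma dist_triangle:
  assumes "u \<in> pverts G" "v \<in> pverts G" "w \<in> pverts G"
  shows "graph_dist G u w \<le> graph_dist G u v + graph_dist G v w"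
proof -
  obtain p where p: "awalk u p v" "graph_dist G u v = real (length p)"
    using assms shortest_walk by blast
  obtain q where q: "awalk v q w" "graph_dist G v w = real (length q)"
    using assms shortest_walk by blast
  show ?thesis
    using dist_le_walk[OF awalk_appendI[OF p(1) q(1)]] p(2) q(2) by simp
qed

lemma dist_arc: "(u, v) \<in> parcs G \<Longrightarrow> graph_dist G u v \<le> 1"
  using dist_le_walk[of u "[(u, v)]" v] arc_implies_awalk[of "(u, v)"] by simp

lemma dist_arc_le:
  assumes "(a, b) \<in> parcs G" "t \<in> pverts G"
  shows "graph_dist G a t \<le> graph_dist G b t + 1"
  using dist_triangle[of a b t] dist_arc[OF assms(1)] wellformed'[OF assms(1)] assms(2) by simp

text \<open>Along a walk \<open>F\<close> drops by at most 1 per arc, hence by at most its length; a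
  shortest walk gives the claim. With \<open>F v = 0\<close> this bounds the distance to
  \<open>v\<close> from below.\<close>

lemma lipschitz_le_dist:
  fixes F :: "'a \<Rightarrow> real"
  assumes F: "\<And>a b. (a, b) \<in> parcs G \<Longrightarrow> F a \<le> F b + 1"
    and "u \<in> pverts G" "v \<in> pverts G"
  shows "F u \<le> F v + graph_dist G u v"
proof -
  have "F u \<le> F v + real (length p)" if "awalk u p v" for p
    using that
  proof (induction p arbitrary: u)
    case Nil
    then show ?case by (simp add: awalk_Nil_iff)
  next
    case (Cons e p)
    then show ?case
      using F[of "fst e" "snd e"] by (fastforce simp: awalk_Cons_iff)
  qed
  then show ?thesis
    using shortest_walk[OF assms(2,3)] by metis
qed

text \<open>Since each arc has its reverse, the distance from a fixed vertex also changes by at most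
  1 along arcs. Applying \<open>lipschitz_le_dist\<close> to it from either end gives both
  inequalities.\<close>

lemma dist_commute:
  assumes "u \<in> pverts G" "v \<in> pverts G"
  shows "graph_dist G u v = graph_dist G v u"
proof -
  have *: "graph_dist G t a \<le> graph_dist G t b + 1" if "(a, b) \<in> parcs G" "t \<in> pverts G" for a b t
    using dist_triangle[of t b a] dist_arc[of b a] arcs_symmetric[OF that(1)]
      wellformed'[OF that(1)] that(2) by simp
  show ?thesis
    using lipschitz_le_dist[of "graph_dist G v" u v, OF *] lipschitz_le_dist[of "graph_dist G u" v u, OF *]
      assms by simp
qed

end

text \<open>The distance to \<open>f v\<close> in \<open>G'\<close>, pulled back along
  \<open>f\<close>, vanishes at \<open>v\<close> and changes by at most 1 along arcs of
  \<open>G\<close>. With \<open>f\<close> the identity on \<open>H\<close> or a gluing map on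
  \<open>K i\<close>, this yields the upper bounds in the graft product.\<close>

lemma dist_hom_le:
  assumes "connected_pair_graph G" "connected_pair_graph G'"
    and f: "f ` pverts G \<subseteq> pverts G'" "map_prod f f ` parcs G \<subseteq> parcs G'"
    and uv: "u \<in> pverts G" "v \<in> pverts G"
  shows "graph_dist G' (f u) (f v) \<le> graph_dist G u v"
proof -
  interpret G: connected_pair_graph G by fact
  interpret G': connected_pair_graph G' by fact
  have "graph_dist G' (f a) (f v) \<le> graph_dist G' (f b) (f v) + 1" if "(a, b) \<in> parcs G" for a b
  proof (rule G'.dist_arc_le)
    show "(f a, f b) \<in> parcs G'"
      using f(2) that by force
    show "f v \<in> pverts G'"
      using f(1) uv by blast
  qed
  then show ?thesis
    using G.lipschitz_le_dist[of "\<lambda>a. graph_dist G' (f a) (f v)" u v] uv f(1)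
    by (simp add: image_subset_iff)
qed

section \<open>Vertices and weighted sums of the graft product\<close>

locale graft_product =
  H: connected_pair_graph H for H :: "'a pair_pre_digraph" +
  fixes r :: nat and K :: "nat \<Rightarrow> 'a pair_pre_digraph" and x y :: "nat \<Rightarrow> 'a"
  assumes K: "i \<in> {1..r} \<Longrightarrow> connected_pair_graph (K i)"
    and disj: "i \<in> {1..r} \<Longrightarrow> pverts H \<inter> pverts (K i) = {}"
    and disj_K: "disjoint_family_on (\<lambda>i. pverts (K i)) {1..r}"
    and x: "i \<in> {1..r} \<Longrightarrow> x i \<in> pverts H"
    and y: "i \<in> {1..r} \<Longrightarrow> y i \<in> pverts (K i)"
begin

abbreviation "G \<equiv> graft H r K x y"
abbreviation "g i \<equiv> glue (x i) (y i)"
abbreviation "d \<equiv> graph_dist G"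
abbreviation "dH \<equiv> graph_dist H"
abbreviation "dK i \<equiv> graph_dist (K i)"

sublocale G: connected_pair_graph G
proof -
  have "pair_graph (K i) \<and> Digraph_Component.connected (with_proj (K i))" if "i \<in> {1..r}" for i
    using K[OF that] by (simp add: connected_pair_graph_def connected_pair_graph_axioms_def)
  then show "connected_pair_graph G"
    using graft_pair_graph[of H r K x y] graft_connected[of H r K x y] H.pair_graph H.connected_G
      disj x y by (simp add: connected_pair_graph_def connected_pair_graph_axioms_def)
qed

lemma finite_K [simp]: "i \<in> {1..r} \<Longrightarrow> finite (pverts (K i))"
proof -
  assume "i \<in> {1..r}"
  then interpret Ki: connected_pair_graph "K i" by (rule K)
  show ?thesis by simp
qed

lemma disj_KD:
  "i \<in> {1..r} \<Longrightarrow> j \<in> {1..r} \<Longrightarrow> v \<in> pverts (K i) \<Longrightarrow> v \<in> pverts (K j) \<Longrightarrow> i = j"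
  using disj_K by (meson disjoint_family_on_def disjoint_iff)

lemma part_eq:
  assumes "i \<in> {1..r}" "v \<in> pverts (K i)"
  shows "(THE i. i \<in> {1..r} \<and> v \<in> pverts (K i)) = i"
  using assms disj_KD by (intro the_equality) blast+

lemma verts_graft: "pverts G = pverts H \<union> (\<Union>i\<in>{1..r}. pverts (K i) - {y i})"
  using x y by (fastforce simp: graft_def glue_def split: if_splits)

text \<open>The pieces are disjoint: \<open>y i\<close> is left out of \<open>K i\<close> because
  its representative \<open>x i\<close> is already counted in \<open>H\<close>.\<close>

lemma sum_verts_graft:
  fixes f :: "'a \<Rightarrow> real"
  shows "(\<Sum>v\<in>pverts G. f v) = (\<Sum>v\<in>pverts H. f v) + (\<Sum>i=1..r. \<Sum>v\<in>pverts (K i) - {y i}. f v)"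
proof -
  have "(\<Sum>v\<in>pverts G. f v) =
      (\<Sum>v\<in>pverts H. f v) + (\<Sum>v\<in>(\<Union>i\<in>{1..r}. pverts (K i) - {y i}). f v)"
    unfolding verts_graft using disj by (intro sum.union_disjoint) (simp, simp, blast)
  also have "(\<Sum>v\<in>(\<Union>i\<in>{1..r}. pverts (K i) - {y i}). f v) =
      (\<Sum>i=1..r. \<Sum>v\<in>pverts (K i) - {y i}. f v)"
    by (intro sum.UNION_disjoint) (simp, simp, blast dest: disj_KD)
  finally show ?thesis .
qed

lemma card_verts_graft:
  "real (card (pverts G)) = real (card (pverts H)) + (\<Sum>i=1..r. real (card (pverts (K i))) - 1)"
proof -
  have "real (card (pverts (K i) - {y i})) = real (card (pverts (K i))) - 1" if "i \<in> {1..r}" for i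
  proof -
    have "card (pverts (K i)) > 0"
      using y[OF that] finite_K[OF that] by (auto simp: card_gt_0_iff)
    then show ?thesis using y[OF that] by (simp add: of_nat_diff)
  qed
  then show ?thesis
    using sum_verts_graft[of "\<lambda>_. 1"] by simp
qed

text \<open>The graft weight is the push-forward of \<alpha> and the \<open>\<beta> i\<close> under
  the gluing maps. In this form each \<open>K i\<close> contributes with all its vertices,
  \<open>y i\<close> included, and coinciding \<open>x i\<close> need no case distinction.\<close>

lemma sum_graft_weight:
  fixes f :: "'a \<Rightarrow> real"
  shows "(\<Sum>v\<in>pverts G. graft_weight H r K x y \<alpha> \<beta> v * f v) =
    (\<Sum>v\<in>pverts H. \<alpha> v * f v) + (\<Sum>i=1..r. \<Sum>v\<in>pverts (K i). \<beta> i v * f (g i v))"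
proof -
  let ?\<gamma> = "graft_weight H r K x y \<alpha> \<beta>"
  have "(\<Sum>v\<in>pverts H. ?\<gamma> v * f v) =
      (\<Sum>v\<in>pverts H. \<alpha> v * f v) + (\<Sum>v\<in>pverts H. \<Sum>i | i \<in> {1..r} \<and> x i = v. \<beta> i (y i) * f (x i))"
    by (simp add: graft_weight_def algebra_simps sum.distrib sum_distrib_left)
  \<comment> \<open>The fibres of \<open>x\<close> over the vertices of \<open>H\<close> partition
    the indices, so each \<open>i\<close> occurs exactly once even if some \<open>x i\<close>
    coincide.\<close>
  also have "(\<Sum>v\<in>pverts H. \<Sum>i | i \<in> {1..r} \<and> x i = v. \<beta> i (y i) * f (x i)) =
      (\<Sum>i=1..r. \<beta> i (y i) * f (x i))"
    using x by (intro sum.group) auto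
  finally have onH: "(\<Sum>v\<in>pverts H. ?\<gamma> v * f v) =
      (\<Sum>v\<in>pverts H. \<alpha> v * f v) + (\<Sum>i=1..r. \<beta> i (y i) * f (x i))" .
  \<comment> \<open>The weight that \<open>x i\<close> received from \<open>y i\<close> supplies the
    term missing from the sum over \<open>K i\<close>.\<close>
  have "(\<Sum>v\<in>pverts (K i) - {y i}. ?\<gamma> v * f v) + \<beta> i (y i) * f (x i) =
      (\<Sum>v\<in>pverts (K i). \<beta> i v * f (g i v))" if i: "i \<in> {1..r}" for i
  proof -
    have "?\<gamma> v * f v = \<beta> i v * f (g i v)" if v: "v \<in> pverts (K i) - {y i}" for v
    proof -
      have "v \<notin> pverts H" "v \<noteq> y i"
        using disj[OF i] v by auto
      then show ?thesis
        using part_eq[OF i, of v] v by (simp add: graft_weight_def glue_def)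
    qed
    then have "(\<Sum>v\<in>pverts (K i) - {y i}. ?\<gamma> v * f v) =
        (\<Sum>v\<in>pverts (K i) - {y i}. \<beta> i v * f (g i v))"
      by (rule sum.cong[OF refl])
    then show ?thesis
      using i y[OF i] by (simp add: sum.remove[of _ "y i"] glue_def)
  qed
  then have "(\<Sum>i=1..r. \<Sum>v\<in>pverts (K i). \<beta> i v * f (g i v)) =
      (\<Sum>i=1..r. (\<Sum>v\<in>pverts (K i) - {y i}. ?\<gamma> v * f v) + \<beta> i (y i) * f (x i))"
    by (intro sum.cong) auto
  then show ?thesis
    unfolding sum_verts_graft onH by (simp add: sum.distrib)
qed

section \<open>Distances in the graft product\<close>

lemma glue_in_graft: "i \<in> {1..r} \<Longrightarrow> v \<in> pverts (K i) \<Longrightarrow> g i v \<in> pverts G"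
  using graft_summands(3)[of i r x y K H] by blast

lemma H_in_graft: "v \<in> pverts H \<Longrightarrow> v \<in> pverts G"
  using graft_summands(1)[of H r K x y] by blast

lemma glue_y [simp]: "g i (y i) = x i"
  by (simp add: glue_def)

lemma dist_H_le: "u \<in> pverts H \<Longrightarrow> v \<in> pverts H \<Longrightarrow> d u v \<le> dH u v"
  using dist_hom_le[of H G id u v] H.connected_pair_graph_axioms G.connected_pair_graph_axioms
    graft_summands(1,2)[of H r K x y] by (simp add: map_prod.id)

lemma dist_K_le:
  "i \<in> {1..r} \<Longrightarrow> u \<in> pverts (K i) \<Longrightarrow> v \<in> pverts (K i) \<Longrightarrow> d (g i u) (g i v) \<le> dK i u v"
  using dist_hom_le[of "K i" G "g i" u v] K G.connected_pair_graph_axioms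
    graft_summands(3,4)[of i r x y K H] by simp

text \<open>Every arc of the graft product comes from a single summand, so the bound per arc can be
  checked there; agreement at the glued vertices makes the combined function restrict correctly to
  each summand.\<close>

lemma lipschitz_glue:
  fixes \<phi> :: "'a \<Rightarrow> real" and \<psi> :: "nat \<Rightarrow> 'a \<Rightarrow> real"
  assumes \<phi>: "\<And>a b. (a, b) \<in> parcs H \<Longrightarrow> \<phi> a \<le> \<phi> b + 1"
    and \<psi>: "\<And>i a b. i \<in> {1..r} \<Longrightarrow> (a, b) \<in> parcs (K i) \<Longrightarrow> \<psi> i a \<le> \<psi> i b + 1"
    and eq: "\<And>i. i \<in> {1..r} \<Longrightarrow> \<psi> i (y i) = \<phi> (x i)"
  obtains F where "\<And>v. v \<in> pverts H \<Longrightarrow> F v = \<phi> v"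
    and "\<And>i v. i \<in> {1..r} \<Longrightarrow> v \<in> pverts (K i) \<Longrightarrow> F (g i v) = \<psi> i v"
    and "\<And>u v. u \<in> pverts G \<Longrightarrow> v \<in> pverts G \<Longrightarrow> F u \<le> F v + d u v"
proof
  let ?F = "\<lambda>v. if v \<in> pverts H then \<phi> v else \<psi> (THE i. i \<in> {1..r} \<and> v \<in> pverts (K i)) v"
  show onH: "?F v = \<phi> v" if "v \<in> pverts H" for v
    using that by simp
  show onK: "?F (g i v) = \<psi> i v" if i: "i \<in> {1..r}" and v: "v \<in> pverts (K i)" for i v
  \<comment> \<open>Only at \<open>y i\<close> does gluing move the vertex into \<open>H\<close>,
    where the value is given by \<phi>; this is where \<open>eq\<close> enters.\<close>
  proof (cases "v = y i")
    case True
    then show ?thesis using eq[OF i] x[OF i] by simp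
  next
    case False
    moreover have "v \<notin> pverts H"
      using disj[OF i] v by auto
    ultimately show ?thesis
      using part_eq[OF i v] by (simp add: glue_def)
  qed
  have "?F a \<le> ?F b + 1" if ab: "(a, b) \<in> parcs G" for a b
  proof (cases "(a, b) \<in> parcs H")
    case True
    then show ?thesis
      using \<phi> H.wellformed' by simp
  next
    case False
    with ab obtain i c e where i: "i \<in> {1..r}" and ce: "(c, e) \<in> parcs (K i)"
      and ab_eq: "a = g i c" "b = g i e"
      by (rule parcs_graftE)
    interpret Ki: connected_pair_graph "K i" using i by (rule K)
    have "c \<in> pverts (K i)" "e \<in> pverts (K i)"
      using Ki.wellformed'[OF ce] by simp_all
    from this[THEN onK[OF i]] show ?thesis
      using \<psi>[OF i ce] unfolding ab_eq by linarith
  qed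
  then show "?F u \<le> ?F v + d u v" if "u \<in> pverts G" "v \<in> pverts G" for u v
    using G.lipschitz_le_dist[of ?F] that by blast
qed

text \<open>The claimed distances define a function to which \<open>lipschitz_glue\<close> applies
  and which vanishes at \<open>t\<close>, so they are lower bounds. The route through
  \<open>x i\<close> shows that they are attained.\<close>

lemma dist_graft_to_H:
  assumes t: "t \<in> pverts H"
  shows "u \<in> pverts H \<Longrightarrow> d u t = dH u t"
    and "i \<in> {1..r} \<Longrightarrow> u \<in> pverts (K i) \<Longrightarrow> d (g i u) t = dK i u (y i) + dH (x i) t"
proof -
  obtain F where F: "\<And>v. v \<in> pverts H \<Longrightarrow> F v = dH v t"
    "\<And>i v. i \<in> {1..r} \<Longrightarrow> v \<in> pverts (K i) \<Longrightarrow> F (g i v) = dK i v (y i) + dH (x i) t"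
    "\<And>u v. u \<in> pverts G \<Longrightarrow> v \<in> pverts G \<Longrightarrow> F u \<le> F v + d u v"
  proof (rule lipschitz_glue[of "\<lambda>v. dH v t" "\<lambda>i v. dK i v (y i) + dH (x i) t"])
    show "dH a t \<le> dH b t + 1" if "(a, b) \<in> parcs H" for a b
      using that t by (rule H.dist_arc_le)
    fix i assume i: "i \<in> {1..r}"
    then interpret Ki: connected_pair_graph "K i" by (rule K)
    show "dK i a (y i) + dH (x i) t \<le> dK i b (y i) + dH (x i) t + 1" if "(a, b) \<in> parcs (K i)" for a b
      using Ki.dist_arc_le[OF that y[OF i]] by simp
    show "dK i (y i) (y i) + dH (x i) t = dH (x i) t"
      using y[OF i] by simp
  qed blast
  have ge: "F u \<le> d u t" if "u \<in> pverts G" for u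
    using F(3)[OF that H_in_graft[OF t]] F(1)[OF t] t by simp
  show "d u t = dH u t" if "u \<in> pverts H"
    using ge[of u] F(1)[OF that] dist_H_le[OF that t] H_in_graft[OF that] by simp
  show "d (g i u) t = dK i u (y i) + dH (x i) t" if i: "i \<in> {1..r}" and u: "u \<in> pverts (K i)"
    using ge[of "g i u"] F(2)[OF i u] dist_H_le[OF x[OF i] t] dist_K_le[OF i u y[OF i]]
      G.dist_triangle[of "g i u" "x i" t] glue_in_graft[OF i u] H_in_graft[OF x[OF i]] H_in_graft[OF t]
    by simp
qed

text \<open>The argument of \<open>dist_graft_to_H\<close> with the target inside
  \<open>K j\<close>. The second claim says that leaving \<open>K j\<close> gives no shortcut, since
  any return passes through \<open>x j\<close> again.\<close>

lemma dist_graft_to_K: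
  assumes j: "j \<in> {1..r}" and t: "t \<in> pverts (K j)"
  shows "u \<in> pverts H \<Longrightarrow> d u (g j t) = dH u (x j) + dK j (y j) t"
    and "u \<in> pverts (K j) \<Longrightarrow> d (g j u) (g j t) = dK j u t"
    and "i \<in> {1..r} \<Longrightarrow> i \<noteq> j \<Longrightarrow> u \<in> pverts (K i) \<Longrightarrow>
      d (g i u) (g j t) = dK i u (y i) + dH (x i) (x j) + dK j (y j) t"
proof -
  \<comment> \<open>The candidate distance to \<open>t\<close>: inside \<open>K j\<close> it is the
    distance of \<open>K j\<close>, elsewhere the length of the route through \<open>x i\<close> and
    \<open>x j\<close>.\<close>
  define \<psi> where "\<psi> i v = (if i = j then dK j v t else dK i v (y i) + dH (x i) (x j) + dK j (y j) t)"
    for i v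
  interpret Kj: connected_pair_graph "K j" using j by (rule K)
  obtain F where F: "\<And>v. v \<in> pverts H \<Longrightarrow> F v = dH v (x j) + dK j (y j) t"
    "\<And>i v. i \<in> {1..r} \<Longrightarrow> v \<in> pverts (K i) \<Longrightarrow> F (g i v) = \<psi> i v"
    "\<And>u v. u \<in> pverts G \<Longrightarrow> v \<in> pverts G \<Longrightarrow> F u \<le> F v + d u v"
  proof (rule lipschitz_glue[of "\<lambda>v. dH v (x j) + dK j (y j) t" \<psi>])
    show "dH a (x j) + dK j (y j) t \<le> dH b (x j) + dK j (y j) t + 1" if "(a, b) \<in> parcs H" for a b
      using H.dist_arc_le[OF that x[OF j]] by simp
    fix i assume i: "i \<in> {1..r}"
    then interpret Ki: connected_pair_graph "K i" by (rule K)
    show "\<psi> i a \<le> \<psi> i b + 1" if "(a, b) \<in> parcs (K i)" for a b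
      using Ki.dist_arc_le[OF that y[OF i]] Kj.dist_arc_le[OF _ t, of a b] that by (auto simp: \<psi>_def)
    \<comment> \<open>For \<open>i = j\<close> the values agree because the distance from
      \<open>x j\<close> to itself is 0.\<close>
    show "\<psi> i (y i) = dH (x i) (x j) + dK j (y j) t"
      using y[OF i] x[OF i] by (auto simp: \<psi>_def)
  qed blast
  have gt: "g j t \<in> pverts G"
    using glue_in_graft[OF j t] .
  have ge: "F u \<le> d u (g j t)" if "u \<in> pverts G" for u
    using F(3)[OF that gt] F(2)[OF j t] t by (simp add: \<psi>_def)
  have H_le: "d u (g j t) \<le> dH u (x j) + dK j (y j) t" if "u \<in> pverts H" for u
    using G.dist_triangle[of u "x j" "g j t"] dist_H_le[OF that x[OF j]] dist_K_le[OF j y[OF j] t] gt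
      H_in_graft[OF x[OF j]] H_in_graft[OF that] by simp
  show "d u (g j t) = dH u (x j) + dK j (y j) t" if "u \<in> pverts H"
    using ge[of u] F(1)[OF that] H_le[OF that] H_in_graft[OF that] by simp
  show "d (g j u) (g j t) = dK j u t" if "u \<in> pverts (K j)"
    using ge[of "g j u"] F(2)[OF j that] dist_K_le[OF j that t] glue_in_graft[OF j that]
    by (simp add: \<psi>_def)
  show "d (g i u) (g j t) = dK i u (y i) + dH (x i) (x j) + dK j (y j) t"
    if i: "i \<in> {1..r}" and ij: "i \<noteq> j" and u: "u \<in> pverts (K i)"
    using ge[of "g i u"] F(2)[OF i u] ij H_le[OF x[OF i]] dist_K_le[OF i u y[OF i]]
      G.dist_triangle[of "g i u" "x i" "g j t"] glue_in_graft[OF i u] H_in_graft[OF x[OF i]] gt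
    by (simp add: \<psi>_def)
qed

section \<open>Moments at single vertices of the graft product\<close>

lemma moment_at_graft_H:
  assumes "t \<in> pverts H"
  shows "moment_at G (graft_weight H r K x y \<alpha> \<beta>) t = moment_at H \<alpha> t +
    (\<Sum>i=1..r. moment_at (K i) (\<beta> i) (y i) + (\<Sum>v\<in>pverts (K i). \<beta> i v) * dH (x i) t)"
  unfolding moment_at_def sum_graft_weight
  by (simp add: dist_graft_to_H[OF assms] distrib_left sum.distrib sum_distrib_right)

text \<open>Compared with the target \<open>x j\<close>, all weight outside \<open>K j\<close>
  travels the extra distance from \<open>y j\<close> to \<open>t\<close>, while the weight of
  \<open>K j\<close> contributes its moment at \<open>t\<close> instead of that at
  \<open>y j\<close>. The last sum keeps \<open>i = j\<close>, whence the subtracted moment.\<close>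

lemma moment_at_graft_K:
  fixes \<beta> :: "nat \<Rightarrow> 'a \<Rightarrow> real"
  assumes j: "j \<in> {1..r}" and t: "t \<in> pverts (K j)"
  defines "Bs \<equiv> \<lambda>i. \<Sum>v\<in>pverts (K i). \<beta> i v"
  shows "moment_at G (graft_weight H r K x y \<alpha> \<beta>) (g j t) =
    moment_at H \<alpha> (x j) + moment_at (K j) (\<beta> j) t - moment_at (K j) (\<beta> j) (y j)
    + ((\<Sum>v\<in>pverts H. \<alpha> v) + (\<Sum>i=1..r. Bs i) - Bs j) * dK j t (y j)
    + (\<Sum>i=1..r. moment_at (K i) (\<beta> i) (y i) + Bs i * dH (x i) (x j))"
proof -
  interpret Kj: connected_pair_graph "K j" using j by (rule K)
  let ?M = "\<lambda>i. moment_at (K i) (\<beta> i) (y i)" and ?D = "dK j t (y j)"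
  let ?S = "\<lambda>i. \<Sum>v\<in>pverts (K i). \<beta> i v * d (g i v) (g j t)"
  have sym: "dK j (y j) t = ?D"
    using Kj.dist_commute[OF y[OF j] t] .
  have onH: "(\<Sum>v\<in>pverts H. \<alpha> v * d v (g j t)) = moment_at H \<alpha> (x j) + (\<Sum>v\<in>pverts H. \<alpha> v) * ?D"
    by (simp add: moment_at_def dist_graft_to_K[OF j t] sym distrib_left sum.distrib sum_distrib_right)
  have onj: "?S j = moment_at (K j) (\<beta> j) t"
    by (simp add: moment_at_def dist_graft_to_K[OF j t])
  have "?S i = ?M i + Bs i * dH (x i) (x j) + Bs i * ?D" if "i \<in> {1..r} - {j}" for i
    using that by (simp add: moment_at_def dist_graft_to_K[OF j t] sym distrib_left sum.distrib
        sum_distrib_right Bs_def)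
  then have "(\<Sum>i=1..r. ?S i) =
      ?S j + (\<Sum>i\<in>{1..r} - {j}. ?M i + Bs i * dH (x i) (x j) + Bs i * ?D)"
    using j by (simp add: sum.remove[of _ j])
  \<comment> \<open>The term for \<open>i = j\<close> is added and subtracted; its part with
    \<open>dH (x j) (x j)\<close> is 0.\<close>
  also have "\<dots> = ?S j - (?M j + Bs j * ?D) + (\<Sum>i=1..r. ?M i + Bs i * dH (x i) (x j) + Bs i * ?D)"
    using j x[OF j] by (simp add: sum.remove[of _ j])
  also have "\<dots> = ?S j - (?M j + Bs j * ?D) + (\<Sum>i=1..r. ?M i + Bs i * dH (x i) (x j)) + (\<Sum>i=1..r. Bs i) * ?D"
    by (simp add: sum.distrib sum_distrib_right)
  finally show ?thesis
    unfolding moment_at_def[of G] sum_graft_weight onH onj by (simp add: algebra_simps)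
qed

end

section \<open>Summation over all targets\<close>

theorem theorem2p1:
  fixes H :: "'a pair_pre_digraph" and r :: nat and K :: "nat \<Rightarrow> 'a pair_pre_digraph"
    and \<alpha> :: "'a \<Rightarrow> real" and \<beta> :: "nat \<Rightarrow> 'a \<Rightarrow> real"
    and x y :: "nat \<Rightarrow> 'a"
    and G :: "'a pair_pre_digraph" and \<gamma> :: "'a \<Rightarrow> real"
    and A B W :: real and Bs :: "nat \<Rightarrow> real"
    and \<xi> \<eta> :: "nat \<Rightarrow> 'a \<Rightarrow> real"
  assumes "pair_graph H" and "Digraph_Component.connected (with_proj H)"
    and "\<And>i. i \<in> {1..r} \<Longrightarrow> pair_graph (K i)"
    and "\<And>i. i \<in> {1..r} \<Longrightarrow> Digraph_Component.connected (with_proj (K i))"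
    and "\<And>i. i \<in> {1..r} \<Longrightarrow> pverts H \<inter> pverts (K i) = {}"
    and "disjoint_family_on (\<lambda>i. pverts (K i)) {1..r}"
    and "\<And>v. v \<in> pverts H \<Longrightarrow> \<alpha> v \<ge> 0"
    and "\<And>i v. i \<in> {1..r} \<Longrightarrow> v \<in> pverts (K i) \<Longrightarrow> \<beta> i v \<ge> 0"
    and "A = (\<Sum>u\<in>pverts H. \<alpha> u)"
    and "\<And>i. i \<in> {1..r} \<Longrightarrow> Bs i = (\<Sum>v\<in>pverts (K i). \<beta> i v)"
    and "B = (\<Sum>i=1..r. Bs i)"
    and "W = A + B"
    and "\<And>i. i \<in> {1..r} \<Longrightarrow> x i \<in> pverts H"
    and "\<And>i. i \<in> {1..r} \<Longrightarrow> y i \<in> pverts (K i)"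
    and "G = graft H r K x y"
    and "\<gamma> = graft_weight H r K x y \<alpha> \<beta>"
    and "\<And>i v. i \<in> {1..r} \<Longrightarrow> v \<in> pverts H \<Longrightarrow>
           \<xi> i v = (real (card (pverts (K i))) - 1) * \<alpha> v + Bs i"
    and "\<And>i v. i \<in> {1..r} \<Longrightarrow> v \<in> pverts (K i) \<Longrightarrow>
           \<eta> i v = (real (card (pverts G)) - real (card (pverts (K i)))) * \<beta> i v + W - Bs i"
  shows "real (card (pverts G)) =
           real (card (pverts H)) + (\<Sum>i=1..r. real (card (pverts (K i)))) - real r
       \<and> moment G \<gamma> =
           moment H \<alpha> + (\<Sum>i=1..r. moment (K i) (\<beta> i))
           + (\<Sum>i=1..r. moment_at H (\<xi> i) (x i))
           + (\<Sum>i=1..r. moment_at (K i) (\<eta> i) (y i))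
           + (\<Sum>i=1..r. \<Sum>j=1..r.
                (real (card (pverts (K i))) - 1) * graph_dist H (x i) (x j) * Bs j)"
proof -
  interpret graft_product H r K x y
    using assms(1-6,13,14)
    by (simp add: graft_product_def graft_product_axioms_def connected_pair_graph_def
        connected_pair_graph_axioms_def)
  note G = assms(15) and \<gamma> = assms(16) and \<xi> = assms(17) and \<eta> = assms(18)
  define n where "n i = real (card (pverts (K i)))" for i
  define N where "N = real (card (pverts G))"
  define h where "h = real (card (pverts H))"
  define M where "M i = moment_at (K i) (\<beta> i) (y i)" for i
  define P where "P = (\<Sum>i=1..r. M i)"
  \<comment> \<open>\<open>T i\<close> and \<open>U i\<close> are the moments of the constant weight
    1 at \<open>x i\<close> and \<open>y i\<close>; \<open>Q j\<close> is the moment at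
    \<open>x j\<close> of the weights \<open>Bs i\<close> placed at the \<open>x i\<close>.\<close>
  define T where "T i = (\<Sum>v\<in>pverts H. dH v (x i))" for i
  define U where "U i = (\<Sum>v\<in>pverts (K i). dK i v (y i))" for i
  define Q where "Q j = (\<Sum>i=1..r. Bs i * dH (x i) (x j))" for j
  have N: "N = h + (\<Sum>i=1..r. n i - 1)"
    using card_verts_graft by (simp add: N_def h_def n_def G)
  have Bs: "(\<Sum>v\<in>pverts (K i). \<beta> i v) = Bs i" if "i \<in> {1..r}" for i
    using assms(10)[OF that] by simp
  have A: "(\<Sum>v\<in>pverts H. \<alpha> v) = A"
    using assms(9) by simp
  have atH: "moment_at G \<gamma> u = moment_at H \<alpha> u + P + (\<Sum>i=1..r. Bs i * dH u (x i))"
    if "u \<in> pverts H" for u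
    using moment_at_graft_H[OF that, of \<alpha> \<beta>] that x
    by (simp add: G \<gamma> Bs sum.distrib P_def M_def H.dist_commute[of u])
  have atK: "moment_at G \<gamma> (g j u) =
      moment_at H \<alpha> (x j) + P + Q j - M j + moment_at (K j) (\<beta> j) u + (W - Bs j) * dK j u (y j)"
    if "j \<in> {1..r}" "u \<in> pverts (K j)" for j u
    using moment_at_graft_K[OF that, of \<alpha> \<beta>] that
    by (simp add: G \<gamma> A Bs sum.distrib P_def Q_def M_def assms(11,12))
  have sumH: "(\<Sum>u\<in>pverts H. moment_at G \<gamma> u) = moment H \<alpha> + h * P + (\<Sum>i=1..r. Bs i * T i)"
  proof -
    have "(\<Sum>u\<in>pverts H. \<Sum>i=1..r. Bs i * dH u (x i)) = (\<Sum>i=1..r. Bs i * T i)"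
      unfolding T_def sum_distrib_left by (rule sum.swap)
    then show ?thesis
      by (simp add: atH sum.distrib moment_def h_def)
  qed
  \<comment> \<open>The factor of \<open>M j\<close> is \<open>n j\<close>, not
    \<open>n j - 1\<close>: in the omitted term at \<open>y j\<close>, the subtracted
    \<open>M j\<close> cancels against the moment of \<open>K j\<close> at
    \<open>y j\<close>.\<close>
  have sumK: "(\<Sum>u\<in>pverts (K j) - {y j}. moment_at G \<gamma> u) =
      (n j - 1) * moment_at H \<alpha> (x j) + (n j - 1) * (P + Q j) - n j * M j + moment (K j) (\<beta> j)
      + (W - Bs j) * U j" if j: "j \<in> {1..r}" for j
  proof -
    interpret Kj: connected_pair_graph "K j" using j by (rule K)
    have "(\<Sum>u\<in>pverts (K j) - {y j}. moment_at G \<gamma> u) =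
        (\<Sum>u\<in>pverts (K j) - {y j}. moment_at G \<gamma> (g j u))"
      by (intro sum.cong) (auto simp: glue_def)
    \<comment> \<open>Completing the sum to all of \<open>K j\<close> makes the full moment of
      \<open>K j\<close> appear.\<close>
    also have "\<dots> = (\<Sum>u\<in>pverts (K j). moment_at G \<gamma> (g j u)) - moment_at G \<gamma> (g j (y j))"
      using y[OF j] by (simp add: sum_diff1)
    also have "(\<Sum>u\<in>pverts (K j). moment_at G \<gamma> (g j u)) =
        n j * (moment_at H \<alpha> (x j) + P + Q j - M j) + moment (K j) (\<beta> j) + (W - Bs j) * U j"
      by (simp add: atK[OF j] sum.distrib moment_def n_def U_def sum_distrib_left)
    also have "moment_at G \<gamma> (g j (y j)) = moment_at H \<alpha> (x j) + P + Q j"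
      unfolding atK[OF j y[OF j]] using y[OF j] by (simp add: M_def)
    finally show ?thesis
      by (simp add: algebra_simps)
  qed
  have xi: "moment_at H (\<xi> i) (x i) = (n i - 1) * moment_at H \<alpha> (x i) + Bs i * T i"
    if "i \<in> {1..r}" for i
    by (simp add: moment_at_def \<xi>[OF that] n_def T_def sum_distrib_left flip: sum.distrib)
      (simp add: algebra_simps)
  have eta: "moment_at (K i) (\<eta> i) (y i) = (N - n i) * M i + (W - Bs i) * U i"
    if "i \<in> {1..r}" for i
    by (simp add: M_def moment_at_def \<eta>[OF that] n_def N_def U_def sum_distrib_left flip: sum.distrib)
      (simp add: algebra_simps)
  \<comment> \<open>Symmetry of the distance is needed, as \<open>Q i\<close> measures towards
    \<open>x i\<close>.\<close>
  have dbl: "(\<Sum>i=1..r. \<Sum>j=1..r. (n i - 1) * dH (x i) (x j) * Bs j) = (\<Sum>i=1..r. (n i - 1) * Q i)"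
    unfolding Q_def sum_distrib_left
    using x by (intro sum.cong refl) (simp add: H.dist_commute mult_ac)
  \<comment> \<open>Each of the \<open>N\<close> targets contributes \<open>P\<close> once. Together
    with the terms \<open>- n i * M i\<close> this produces the factor \<open>N - n i\<close> in
    \<open>eta\<close>.\<close>
  have NP: "h * P + (\<Sum>i=1..r. (n i - 1) * P) = (\<Sum>i=1..r. N * M i)"
    unfolding sum_distrib_left[symmetric] sum_distrib_right[symmetric] P_def[symmetric] N
    by (rule distrib_right[symmetric])
  have "moment G \<gamma> = (\<Sum>u\<in>pverts H. moment_at G \<gamma> u)
      + (\<Sum>j=1..r. \<Sum>u\<in>pverts (K j) - {y j}. moment_at G \<gamma> u)"
    using sum_verts_graft by (simp add: moment_def G)
  \<comment> \<open>The terms are grouped to match \<open>xi\<close>, \<open>eta\<close> and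
    \<open>dbl\<close>: \<open>Bs i * T i\<close> is the constant part of \<open>\<xi> i\<close>,
    and \<open>(W - Bs i) * U i\<close> that of \<open>\<eta> i\<close>.\<close>
  also have "\<dots> = moment H \<alpha> + (h * P + (\<Sum>i=1..r. (n i - 1) * P)) + (\<Sum>i=1..r. moment (K i) (\<beta> i))
      + (\<Sum>i=1..r. (n i - 1) * moment_at H \<alpha> (x i) + Bs i * T i)
      + (\<Sum>i=1..r. (W - Bs i) * U i - n i * M i) + (\<Sum>i=1..r. (n i - 1) * Q i)"
    by (simp add: sumH sumK distrib_left sum.distrib sum_subtractf)
  also have "\<dots> = moment H \<alpha> + (\<Sum>i=1..r. moment (K i) (\<beta> i))
      + (\<Sum>i=1..r. moment_at H (\<xi> i) (x i)) + (\<Sum>i=1..r. moment_at (K i) (\<eta> i) (y i))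
      + (\<Sum>i=1..r. \<Sum>j=1..r. (n i - 1) * dH (x i) (x j) * Bs j)"
    unfolding NP dbl by (simp add: xi eta left_diff_distrib sum.distrib sum_subtractf)
  finally show ?thesis
    using N by (simp add: N_def h_def n_def sum_subtractf)
qed

end
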